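(* Consider any infinitesimally minimally rigid formation in $\mathbb{R}^2$ that is generated, starting from a triangular formation, by a sequence of Henneberg insertion operations. Suppose the estimating agents are chosen following exactly the sequence of Henneberg insertions, as follows: (i) for the first three agents (the initial triangle), either each of the three agents is the estimating agent for exactly one edge of the triangle, or one agent is the estimating agent for both of its two triangle edges and exactly one other agent is the estimating agent for the remaining triangle edge; (ii) for each new insertion operation, which adds two edges from a new agent to two existing agents, those two existing agents are the estimating agents for the two newly added edges (each for the new edge it is an endpoint of), and all other choices are unaffected. Then the associated matrix $Z=-R(z^* )R(z^* )^T+R(z^* )S_1(z^* )^T$ is Hurwitz.
   Context: $\mathbb G$ is an undirected graph on $\{1,\dots,n\}$ with edge set $\mathcal E$, and agent $i$ has position $x_i\in\mathbb{R}^m$ (here $m=2$). For each edge $k$ exactly one of its two endpoints is designated the estimating agent of edge $k$. If $i$ is the estimating agent of edge $k$ and $j$ is the other endpoint, put $z_k=x_i-x_j$ and $z=\operatorname{col}(z_k)$. $H\in\mathbb{R}^{|\mathcal E|\times n}$ has in row $k$ the entry $+1$ at the estimating agent of edge $k$, $-1$ at the other endpoint, and $0$ elsewhere. $D(z)=\operatorname{diag}\{z_k\}\in\mathbb{R}^{m|\mathcal E|\times|\mathcal E|}$ is block diagonal with the column vectors $z_k$ as blocks. The rigidity matrix is $R(z)=D(z)^T(H\otimes I_m)$, and $S_1(z)=D(z)^TJ$, where $J$ is obtained from $H\otimes I_m$ by replacing every entry $-1$ by $0$. $z^*$ is the vector of relative positions of the desired framework (the one realizing the prescribed edge distances). A framework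 in $\mathbb{R}^2$ is infinitesimally rigid if its rigidity matrix has rank $2n-3$, and minimally so if moreover it has exactly $2n-3$ edges; the formation is infinitesimally minimally rigid if the desired framework is. Henneberg insertion operation: add a new vertex to the graph, together with edges connecting it to two previously existing vertices. A real square matrix is Hurwitz if all its eigenvalues have negative real part. *)

theory Defs
  imports "HOL-Analysis.Analysis"
begin

text \<open>
  Vertices (agents) are the elements of a finite type \<open>'n\<close>, so \<open>n = CARD('n)\<close>, and
  edges are labelled by a finite type \<open>'e\<close>: an injective map \<open>edge\<close> sends a label \<open>k\<close> to the
  two-element set of endpoints of edge \<open>k\<close>, and the edge set is \<open>range edge\<close>.
  The function \<open>est\<close> sends an edge (as a set of endpoints) to its estimating agent.
  Stacked vectors and block matrices with blocks of size \<open>m = CARD('m)\<close> are indexed by pairs: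
  the index \<open>(k, p)\<close> is coordinate \<open>p\<close> of block \<open>k\<close>.
\<close>

definition other_endpoint :: "('n set \<Rightarrow> 'n) \<Rightarrow> 'n set \<Rightarrow> 'n" where
  "other_endpoint est e = the_elem (e - {est e})"

definition relative_positions ::
    "('e::finite \<Rightarrow> 'n::finite set) \<Rightarrow> ('n set \<Rightarrow> 'n) \<Rightarrow> ('n \<Rightarrow> real^'m::finite) \<Rightarrow> real^'m^'e" where
  "relative_positions edge est x =
     (\<chi> k. x (est (edge k)) - x (other_endpoint est (edge k)))"

definition incidence_matrix ::
    "('e::finite \<Rightarrow> 'n::finite set) \<Rightarrow> ('n set \<Rightarrow> 'n) \<Rightarrow> real^'n^'e" where
  "incidence_matrix edge est =
     (\<chi> k i. if i = est (edge k) then 1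
             else if i = other_endpoint est (edge k) then - 1 else 0)"

definition kronecker :: "real^'b::finite^'a::finite \<Rightarrow> real^'d::finite^'c::finite \<Rightarrow> real^('b \<times> 'd)^('a \<times> 'c)" where
  "kronecker A B = (\<chi> r c. A $ fst r $ fst c * B $ snd r $ snd c)"

definition D_matrix :: "real^'m::finite^'e::finite \<Rightarrow> real^'e^('e \<times> 'm)" where
  "D_matrix z = (\<chi> r k. if fst r = k then z $ k $ snd r else 0)"

definition rigidity_matrix ::
    "('e::finite \<Rightarrow> 'n::finite set) \<Rightarrow> ('n set \<Rightarrow> 'n) \<Rightarrow> real^'m::finite^'e \<Rightarrow> real^('n \<times> 'm)^'e" where
  "rigidity_matrix edge est z =
     transpose (D_matrix z) ** kronecker (incidence_matrix edge est) (mat 1 :: real^'m^'m)"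

definition J_matrix ::
    "('e::finite \<Rightarrow> 'n::finite set) \<Rightarrow> ('n set \<Rightarrow> 'n) \<Rightarrow> real^('n \<times> 'm::finite)^('e \<times> 'm)" where
  "J_matrix edge est =
     (\<chi> r c. let h = kronecker (incidence_matrix edge est) (mat 1 :: real^'m^'m) $ r $ c
             in if h = - 1 then 0 else h)"

definition S1_matrix ::
    "('e::finite \<Rightarrow> 'n::finite set) \<Rightarrow> ('n set \<Rightarrow> 'n) \<Rightarrow> real^'m::finite^'e \<Rightarrow> real^('n \<times> 'm)^'e" where
  "S1_matrix edge est z = transpose (D_matrix z) ** J_matrix edge est"

definition Z_matrix ::
    "('e::finite \<Rightarrow> 'n::finite set) \<Rightarrow> ('n set \<Rightarrow> 'n) \<Rightarrow> real^'m::finite^'e \<Rightarrow> real^'e^'e" where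
  "Z_matrix edge est z =
     - (rigidity_matrix edge est z ** transpose (rigidity_matrix edge est z))
     + rigidity_matrix edge est z ** transpose (S1_matrix edge est z)"

text \<open>The rank condition does not depend on \<open>est\<close>, which only fixes the signs in \<open>z\<close> and \<open>H\<close>.\<close>

definition infinitesimally_rigid ::
    "('e::finite \<Rightarrow> 'n::finite set) \<Rightarrow> ('n set \<Rightarrow> 'n) \<Rightarrow> ('n \<Rightarrow> real^2) \<Rightarrow> bool" where
  "infinitesimally_rigid edge est x \<longleftrightarrow>
     int (rank (rigidity_matrix edge est (relative_positions edge est x))) = 2 * int CARD('n) - 3"

definition infinitesimally_minimally_rigid ::
    "('e::finite \<Rightarrow> 'n::finite set) \<Rightarrow> ('n set \<Rightarrow> 'n) \<Rightarrow> ('n \<Rightarrow> real^2) \<Rightarrow> bool" where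
  "infinitesimally_minimally_rigid edge est x \<longleftrightarrow>
     infinitesimally_rigid edge est x \<and> int (card (range edge)) = 2 * int CARD('n) - 3"

definition triangle_choice :: "('n set \<Rightarrow> 'n) \<Rightarrow> 'n set \<Rightarrow> 'n set set \<Rightarrow> bool" where
  "triangle_choice est V T \<longleftrightarrow>
     (\<forall>i\<in>V. \<exists>!e. e \<in> T \<and> est e = i) \<or>
     (\<exists>i\<in>V. \<exists>j\<in>V. j \<noteq> i \<and> (\<forall>e\<in>T. i \<in> e \<longrightarrow> est e = i) \<and> (\<forall>e\<in>T. i \<notin> e \<longrightarrow> est e = j))"

text \<open>
  \<open>henneberg est V E\<close>: the graph \<open>(V, E)\<close> arises from a triangle by Henneberg insertions, and the
  estimating agents are chosen along that same sequence. As \<open>est\<close> is fixed throughout, an insertion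
  leaves the choices for all previous edges unaffected.
\<close>

inductive henneberg :: "('n set \<Rightarrow> 'n) \<Rightarrow> 'n set \<Rightarrow> 'n set set \<Rightarrow> bool"
  for est :: "'n set \<Rightarrow> 'n" where
  triangle: "\<lbrakk>a \<noteq> b; b \<noteq> c; a \<noteq> c; triangle_choice est {a, b, c} {{a, b}, {b, c}, {a, c}}\<rbrakk>
    \<Longrightarrow> henneberg est {a, b, c} {{a, b}, {b, c}, {a, c}}"
| insertion: "\<lbrakk>henneberg est V E; v \<notin> V; a \<in> V; b \<in> V; a \<noteq> b; est {v, a} = a; est {v, b} = b\<rbrakk>
    \<Longrightarrow> henneberg est (insert v V) (E \<union> {{v, a}, {v, b}})"

definition complex_eigenvalue :: "real^'k::finite^'k \<Rightarrow> complex \<Rightarrow> bool" where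
  "complex_eigenvalue A \<mu> \<longleftrightarrow>
     (\<exists>v :: complex^'k. v \<noteq> 0 \<and> (\<chi> i j. complex_of_real (A $ i $ j)) *v v = \<mu> *s v)"

definition hurwitz :: "real^'k::finite^'k \<Rightarrow> bool" where
  "hurwitz A \<longleftrightarrow> (\<forall>\<mu>. complex_eigenvalue A \<mu> \<longrightarrow> Re \<mu> < 0)"

end

theory Submission
  imports Defs
begin

text \<open>
  The entry of \<open>Z\<close> at \<open>(k, l)\<close> is the inner product of \<open>z\<^sub>k\<close> and \<open>z\<^sub>l\<close> times the entry of \<open>H\<close> in
  row \<open>k\<close> at the non-estimating endpoint of edge \<open>l\<close>. Inserting a vertex which estimates neither of
  its two edges therefore makes \<open>Z\<close> block triangular, the new diagonal block being minus the Gram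
  matrix of the two new relative positions. A triangle with one agent estimating two edges is itself
  such an insertion, onto a single edge. For a cyclic triangle, an eigenvalue \<open>\<mu>\<close> satisfies
  \<open>(\<mu> + A) (\<mu> + B) (\<mu> + C) = P\<close>, where \<open>A, B, C\<close> are the squared side lengths and \<open>P\<close> is the product
  of the inner products of the sides; since \<open>\<bar>P\<bar> < A B C\<close>, this is impossible for \<open>Re \<mu> \<ge> 0\<close>.

  The Gram matrices are nonsingular because the rows of \<open>R\<close> are independent: if the graph built so
  far has only trivial flexes, the lengths of two new edges with parallel directions cannot be
  varied independently.
\<close>

section \<open>Plane vectors: cross product and rotation by a right angle\<close>

definition cross2 :: "real^2 \<Rightarrow> real^2 \<Rightarrow> real" where
  "cross2 p q = p $ 1 * q $ 2 - p $ 2 * q $ 1"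

text \<open>\<open>r *\<^sub>R perp p\<close> is the velocity at \<open>p\<close> of an
  infinitesimal rotation about the origin.\<close>

definition perp :: "real^2 \<Rightarrow> real^2" where
  "perp p = vector [- (p $ 2), p $ 1]"

lemma perp_nth [simp]: "perp p $ 1 = - (p $ 2)" "perp p $ 2 = p $ 1"
  by (simp_all add: perp_def)

lemma inner_real2: "(p :: real^2) \<bullet> q = p $ 1 * q $ 1 + p $ 2 * q $ 2"
  by (simp add: inner_vec_def sum_2)

lemma lagrange_identity: "(p \<bullet> p) * (q \<bullet> q) = (p \<bullet> q)\<^sup>2 + (cross2 p q)\<^sup>2"
  by (simp add: inner_real2 cross2_def power2_eq_square algebra_simps)

text \<open>Binet-Cauchy: the two sides differ by \<open>cross2 p q * cross2 p y\<close>. The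
  division-free form also covers \<open>p = 0\<close>.\<close>

lemma cross2_zero_parallel: "cross2 p q = 0 \<Longrightarrow> (p \<bullet> p) * (q \<bullet> y) = (p \<bullet> q) * (p \<bullet> y)"
proof -
  have "(p \<bullet> p) * (q \<bullet> y) - (p \<bullet> q) * (p \<bullet> y) = cross2 p q * (p $ 1 * y $ 2 - p $ 2 * y $ 1)"
    by (simp add: inner_real2 cross2_def algebra_simps)
  then show "cross2 p q = 0 \<Longrightarrow> ?thesis" by simp
qed

lemma cross2_nonzero_inner_zero:
  assumes "cross2 p q \<noteq> 0" "p \<bullet> y = 0" "q \<bullet> y = 0"
  shows "y = 0"
proof -
  \<comment> \<open>Cramer's rule for the linear system with rows \<open>p\<close> and
    \<open>q\<close>.\<close>
  have "cross2 p q * y $ 1 = q $ 2 * (p \<bullet> y) - p $ 2 * (q \<bullet> y)"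
    "cross2 p q * y $ 2 = p $ 1 * (q \<bullet> y) - q $ 1 * (p \<bullet> y)"
    by (simp_all add: inner_real2 cross2_def algebra_simps)
  with assms show ?thesis by (simp add: vec_eq_iff forall_2)
qed

lemma cross2_nonzero_pos:
  assumes "cross2 p q \<noteq> 0"
  shows "p \<bullet> p > 0" "q \<bullet> q > 0" "(p \<bullet> q)\<^sup>2 < (p \<bullet> p) * (q \<bullet> q)"
proof -
  have "p \<noteq> 0" "q \<noteq> 0" using assms by (auto simp: cross2_def)
  then show "p \<bullet> p > 0" "q \<bullet> q > 0" by simp_all
  show "(p \<bullet> q)\<^sup>2 < (p \<bullet> p) * (q \<bullet> q)" using assms by (simp add: lagrange_identity)
qed

section \<open>Diagonal blocks have no eigenvalue in the closed right half-plane\<close>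

lemma norm_add_of_real_ge: "Re \<mu> \<ge> 0 \<Longrightarrow> A \<ge> 0 \<Longrightarrow> A \<le> norm (\<mu> + of_real A)"
  using complex_Re_le_cmod[of "\<mu> + of_real A"] by simp

lemma add_of_real_nonzero: "Re \<mu> \<ge> 0 \<Longrightarrow> A > 0 \<Longrightarrow> \<mu> + of_real A \<noteq> 0"
  by (auto simp: complex_eq_iff)

text \<open>The equations say that \<open>(w1, w2)\<close> is an eigenvector of minus the Gram
  matrix of \<open>p\<close> and \<open>q\<close>. For \<open>Re \<mu> \<ge> 0\<close> the factors
  \<open>\<mu> + of_real (p \<bullet> p)\<close> and \<open>\<mu> + of_real (q \<bullet> q)\<close>
  are in modulus at least their values at \<open>\<mu> = 0\<close>, so strict Cauchy-Schwarz keeps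
  the determinant away from 0.\<close>

lemma gram_block_stable:
  fixes w1 w2 \<mu> :: complex
  assumes "Re \<mu> \<ge> 0" "cross2 p q \<noteq> 0"
    and e1: "- of_real (p \<bullet> p) * w1 - of_real (p \<bullet> q) * w2 = \<mu> * w1"
    and e2: "- of_real (p \<bullet> q) * w1 - of_real (q \<bullet> q) * w2 = \<mu> * w2"
  shows "w1 = 0" "w2 = 0"
proof -
  let ?A = "p \<bullet> p" and ?B = "q \<bullet> q" and ?P = "p \<bullet> q"
  note pos = cross2_nonzero_pos[OF assms(2)]
  have n: "?A \<le> norm (\<mu> + of_real ?A)" "?B \<le> norm (\<mu> + of_real ?B)"
    using assms(1) by (simp_all add: norm_add_of_real_ge)
  have f1: "(\<mu> + of_real ?A) * w1 = - of_real ?P * w2"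
    and f2: "(\<mu> + of_real ?B) * w2 = - of_real ?P * w1"
    using e1 e2 by algebra+
  then have "(\<mu> + of_real ?A) * (\<mu> + of_real ?B) * w1 = of_real (?P\<^sup>2) * w1"
    by (simp add: power2_eq_square) algebra
  moreover have "(\<mu> + of_real ?A) * (\<mu> + of_real ?B) \<noteq> of_real (?P\<^sup>2)"
  proof
    assume "(\<mu> + of_real ?A) * (\<mu> + of_real ?B) = of_real (?P\<^sup>2)"
    then have "norm (\<mu> + of_real ?A) * norm (\<mu> + of_real ?B) = ?P\<^sup>2"
      by (metis norm_mult norm_of_real abs_power2)
    moreover have "?A * ?B \<le> norm (\<mu> + of_real ?A) * norm (\<mu> + of_real ?B)"
      using n pos by (intro mult_mono) auto
    ultimately show False using pos(3) by linarith
  qed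
  ultimately show w1: "w1 = 0" by simp
  have "\<mu> + of_real ?B \<noteq> 0" using assms(1) pos(2) by (rule add_of_real_nonzero)
  with f2 w1 show "w2 = 0" by simp
qed

lemma cyclic_block_stable:
  fixes w1 w2 w3 \<mu> :: complex
  assumes "Re \<mu> \<ge> 0" and pos: "A > 0" "B > 0" "C > 0" and less: "\<bar>P * Q * S\<bar> < A * B * C"
    and e1: "of_real P * w3 - of_real A * w1 = \<mu> * w1"
    and e2: "of_real Q * w1 - of_real B * w2 = \<mu> * w2"
    and e3: "of_real S * w2 - of_real C * w3 = \<mu> * w3"
  shows "w1 = 0" "w2 = 0" "w3 = 0"
proof -
  have n: "A \<le> norm (\<mu> + of_real A)" "B \<le> norm (\<mu> + of_real B)" "C \<le> norm (\<mu> + of_real C)"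
    using assms by (simp_all add: norm_add_of_real_ge)
  let ?X = "(\<mu> + of_real A) * (\<mu> + of_real B) * (\<mu> + of_real C)"
  have f1: "(\<mu> + of_real A) * w1 = of_real P * w3"
    and f2: "(\<mu> + of_real B) * w2 = of_real Q * w1"
    and f3: "(\<mu> + of_real C) * w3 = of_real S * w2"
    using e1 e2 e3 by algebra+
  \<comment> \<open>Substituting the equations into each other once round the cycle returns to
    \<open>w1\<close>, with the factor \<open>P * Q * S\<close>.\<close>
  then have "?X * w1 = of_real (P * Q * S) * w1"
    by simp algebra
  moreover have "?X \<noteq> of_real (P * Q * S)"
  proof
    assume "?X = of_real (P * Q * S)"
    then have "norm (\<mu> + of_real A) * norm (\<mu> + of_real B) * norm (\<mu> + of_real C) = \<bar>P * Q * S\<bar>"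
      by (metis norm_mult norm_of_real)
    moreover have "A * B * C \<le> norm (\<mu> + of_real A) * norm (\<mu> + of_real B) * norm (\<mu> + of_real C)"
      using n pos by (intro mult_mono) auto
    ultimately show False using less by linarith
  qed
  ultimately show w1: "w1 = 0" by simp
  have "\<mu> + of_real B \<noteq> 0" "\<mu> + of_real C \<noteq> 0"
    using assms(1) pos by (simp_all add: add_of_real_nonzero)
  with f2 f3 w1 show "w2 = 0" "w3 = 0" by auto
qed

section \<open>Infinitesimal rigidity and the matrix Z, indexed by edges\<close>

text \<open>Row independence of the rigidity matrix, phrased as surjectivity: \<open>g\<close>
  prescribes first-order rates of half the squared edge lengths, and \<open>u\<close> is a velocity
  field attaining them. The product is symmetric in \<open>p\<close> and \<open>q\<close>, so no
  orientation of edges enters.\<close>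

definition independent_lengths :: "('n \<Rightarrow> real^2) \<Rightarrow> 'n set set \<Rightarrow> bool" where
  "independent_lengths x E \<longleftrightarrow>
     (\<forall>g. \<exists>u. \<forall>p q. {p, q} \<in> E \<longrightarrow> (x p - x q) \<bullet> (u p - u q) = g {p, q})"

text \<open>Infinitesimal rigidity through the kernel of the rigidity matrix: on \<open>V\<close> a
  flex is a translation plus an infinitesimal rotation.\<close>

definition only_trivial_flexes :: "('n \<Rightarrow> real^2) \<Rightarrow> 'n set \<Rightarrow> 'n set set \<Rightarrow> bool" where
  "only_trivial_flexes x V E \<longleftrightarrow>
     (\<forall>u. (\<forall>p q. {p, q} \<in> E \<longrightarrow> (x p - x q) \<bullet> (u p - u q) = 0) \<longrightarrow>
        (\<exists>c r. \<forall>p\<in>V. u p = c + r *\<^sub>R perp (x p)))"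

lemma independent_lengthsD:
  assumes "independent_lengths x E"
  obtains u where "\<And>p q. {p, q} \<in> E \<Longrightarrow> (x p - x q) \<bullet> (u p - u q) = g {p, q}"
proof -
  from assms have "\<exists>u. \<forall>p q. {p, q} \<in> E \<longrightarrow> (x p - x q) \<bullet> (u p - u q) = g {p, q}"
    unfolding independent_lengths_def by (rule spec)
  then show thesis using that by auto
qed

lemma only_trivial_flexesD:
  assumes "only_trivial_flexes x V E"
    and "\<And>p q. {p, q} \<in> E \<Longrightarrow> (x p - x q) \<bullet> (u p - u q) = 0"
  obtains c r where "\<And>p. p \<in> V \<Longrightarrow> u p = c + r *\<^sub>R perp (x p)"
proof -
  have "\<exists>c r. \<forall>p\<in>V. u p = c + r *\<^sub>R perp (x p)"
    by (rule assms(1)[unfolded only_trivial_flexes_def, THEN spec, THEN mp]) (simp add: assms(2))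
  then show thesis using that by auto
qed

definition rel_pos :: "('n set \<Rightarrow> 'n) \<Rightarrow> ('n \<Rightarrow> real^2) \<Rightarrow> 'n set \<Rightarrow> real^2" where
  "rel_pos est x e = x (est e) - x (other_endpoint est e)"

text \<open>Indexed by edges instead of labels, an entry does not depend on the rest of the graph,
  so a subgraph yields a principal submatrix.\<close>

definition Z_entry :: "('n set \<Rightarrow> 'n) \<Rightarrow> ('n \<Rightarrow> real^2) \<Rightarrow> 'n set \<Rightarrow> 'n set \<Rightarrow> real" where
  "Z_entry est x e f = (rel_pos est x e \<bullet> rel_pos est x f) *
     (if other_endpoint est f = est e then 1
      else if other_endpoint est f = other_endpoint est e then - 1 else 0)"

text \<open>The Hurwitz property of the block of Z indexed by \<open>E\<close>. Summing over a set,
  not over a matrix index type, lets \<open>E\<close> grow in an induction.\<close>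

definition no_unstable_mode :: "('n set \<Rightarrow> 'n) \<Rightarrow> ('n \<Rightarrow> real^2) \<Rightarrow> 'n set set \<Rightarrow> bool" where
  "no_unstable_mode est x E \<longleftrightarrow>
     (\<forall>\<mu> w. Re \<mu> \<ge> 0 \<longrightarrow> (\<forall>e\<in>E. (\<Sum>f\<in>E. of_real (Z_entry est x e f) * w f) = \<mu> * w e) \<longrightarrow>
        (\<forall>e\<in>E. w e = 0))"

lemma other_endpoint_eq:
  assumes "p \<noteq> q" "est {p, q} = p"
  shows "other_endpoint est {p, q} = q" "other_endpoint est {q, p} = q"
proof -
  have "{p, q} - {p} = {q}" using assms(1) by auto
  then show "other_endpoint est {p, q} = q" using assms by (simp add: other_endpoint_def)
  then show "other_endpoint est {q, p} = q" by (simp add: insert_commute)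
qed

lemma other_endpoint_in:
  assumes "card e = 2" "est e \<in> e"
  shows "other_endpoint est e \<in> e" "other_endpoint est e \<noteq> est e"
    "e = {est e, other_endpoint est e}"
proof -
  obtain q where e: "e = {est e, q}" "q \<noteq> est e"
    using assms by (metis card_2_iff doubleton_eq_iff insertE singletonD)
  then have "other_endpoint est e = q"
    by (metis other_endpoint_eq(1))
  with e show "other_endpoint est e \<in> e" "other_endpoint est e \<noteq> est e"
    "e = {est e, other_endpoint est e}" by auto
qed

lemma independent_lengths_mono:
  "independent_lengths x E \<Longrightarrow> F \<subseteq> E \<Longrightarrow> independent_lengths x F"
  unfolding independent_lengths_def by (meson subsetD)

section \<open>Inserting a vertex\<close>

text \<open>With the old lengths frozen, \<open>V\<close> moves rigidly. Relative to that motion a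
  single velocity of \<open>v\<close> must produce both new rates, which parallel directions would
  tie together.\<close>

lemma insertion_nondegenerate:
  assumes flex: "only_trivial_flexes x V E"
    and indep: "independent_lengths x (E \<union> {{v, a}, {v, b}})"
    and sub: "\<And>e. e \<in> E \<Longrightarrow> e \<subseteq> V"
    and v: "v \<notin> V" "a \<in> V" "b \<in> V" "a \<noteq> b"
  shows "cross2 (x v - x a) (x v - x b) \<noteq> 0"
proof
  let ?p = "x v - x a" and ?q = "x v - x b"
  assume cross: "cross2 ?p ?q = 0"
  have realizable: "\<exists>y. ?p \<bullet> y = \<alpha> \<and> ?q \<bullet> y = \<beta>" for \<alpha> \<beta>
  proof -
    \<comment> \<open>Rate 0 on the old edges, arbitrary rates on the two new ones.\<close>
    define g where "g e = (if e = {v, a} then \<alpha> else if e = {v, b} then \<beta> else 0)" for e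
    obtain u where
      u: "\<And>p q. {p, q} \<in> E \<union> {{v, a}, {v, b}} \<Longrightarrow> (x p - x q) \<bullet> (u p - u q) = g {p, q}"
      using independent_lengthsD[OF indep] by blast
    have "(x p - x q) \<bullet> (u p - u q) = 0" if "{p, q} \<in> E" for p q
    proof -
      have "v \<notin> {p, q}" using sub[OF that] v by auto
      then have "g {p, q} = 0" by (auto simp: g_def)
      with u[of p q] that show ?thesis by simp
    qed
    then obtain c r where triv: "\<And>p. p \<in> V \<Longrightarrow> u p = c + r *\<^sub>R perp (x p)"
      using only_trivial_flexesD[OF flex, of u] by blast
    \<comment> \<open>The velocity of \<open>v\<close> relative to the trivial motion of
      \<open>V\<close>. In the products below the rotational part drops out, being orthogonal to
      \<open>x v - x p\<close>.\<close>
    let ?y = "u v - c - r *\<^sub>R perp (x v)"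
    have *: "(x v - x p) \<bullet> ?y = (x v - x p) \<bullet> (u v - u p)" if "p \<in> V" for p
      using triv[OF that] by (simp add: inner_real2 algebra_simps)
    have "{v, b} \<noteq> {v, a}" using v by (auto simp: doubleton_eq_iff)
    then have "g {v, a} = \<alpha>" "g {v, b} = \<beta>" by (simp_all add: g_def)
    with *[of a] *[of b] u[of v a] u[of v b] v show ?thesis by (intro exI[of _ ?y]) simp
  qed
  show False
  proof (cases "?p = 0")
    case True
    with realizable[of 1 0] show False by simp
  next
    case False
    \<comment> \<open>Parallelism makes \<open>?q \<bullet> y\<close> a multiple of
      \<open>?p \<bullet> y\<close>, hence 0.\<close>
    obtain y where y: "?p \<bullet> y = 0" "?q \<bullet> y = 1" using realizable by blast
    from cross2_zero_parallel[OF cross, of y] y False show False by simp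
  qed
qed

text \<open>The velocity of \<open>v\<close> relative to the trivial motion of \<open>V\<close> is
  orthogonal to two independent directions, so it vanishes and \<open>v\<close> joins that
  motion.\<close>

lemma insertion_only_trivial_flexes:
  assumes flex: "only_trivial_flexes x V E"
    and cross: "cross2 (x v - x a) (x v - x b) \<noteq> 0"
    and v: "a \<in> V" "b \<in> V"
  shows "only_trivial_flexes x (insert v V) (E \<union> {{v, a}, {v, b}})"
  unfolding only_trivial_flexes_def
proof (intro allI impI)
  fix u
  assume u: "\<forall>p q. {p, q} \<in> E \<union> {{v, a}, {v, b}} \<longrightarrow> (x p - x q) \<bullet> (u p - u q) = 0"
  then have "\<forall>p q. {p, q} \<in> E \<longrightarrow> (x p - x q) \<bullet> (u p - u q) = 0" by blast
  then obtain c r where triv: "\<And>p. p \<in> V \<Longrightarrow> u p = c + r *\<^sub>R perp (x p)"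
    using only_trivial_flexesD[OF flex, of u] by blast
  let ?y = "u v - c - r *\<^sub>R perp (x v)"
  have *: "(x v - x p) \<bullet> ?y = (x v - x p) \<bullet> (u v - u p)" if "p \<in> V" for p
    using triv[OF that] by (simp add: inner_real2 algebra_simps)
  have "?y = 0"
    by (rule cross2_nonzero_inner_zero[OF cross]) (use * v u in auto)
  then have "u v = c + r *\<^sub>R perp (x v)" by (simp add: algebra_simps)
  with triv show "\<exists>c r. \<forall>p\<in>insert v V. u p = c + r *\<^sub>R perp (x p)" by blast
qed

lemma insertion_no_unstable_mode:
  assumes stable: "no_unstable_mode est x E"
    and cross: "cross2 (x v - x a) (x v - x b) \<noteq> 0"
    and E: "finite E" "\<And>e. e \<in> E \<Longrightarrow> e \<subseteq> V \<and> card e = 2 \<and> est e \<in> e"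
    and v: "v \<notin> V" "a \<in> V" "b \<in> V" "a \<noteq> b" and est: "est {v, a} = a" "est {v, b} = b"
  shows "no_unstable_mode est x (E \<union> {{v, a}, {v, b}})"
  unfolding no_unstable_mode_def
proof (intro allI impI)
  fix \<mu> :: complex and w
  let ?E = "E \<union> {{v, a}, {v, b}}" and ?Z = "Z_entry est x"
  assume \<mu>: "Re \<mu> \<ge> 0"
    and "\<forall>e\<in>?E. (\<Sum>f\<in>?E. of_real (?Z e f) * w f) = \<mu> * w e"
  then have eig: "(\<Sum>f\<in>?E. of_real (?Z e f) * w f) = \<mu> * w e" if "e \<in> ?E" for e
    using that by blast
  have "v \<noteq> a" "v \<noteq> b" using v by auto
  have new: "{v, a} \<notin> E" "{v, b} \<notin> E" "{v, a} \<noteq> {v, b}"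
    using E(2) v by (auto simp: doubleton_eq_iff)
  have oth: "other_endpoint est {v, a} = v" "other_endpoint est {v, b} = v"
    using est \<open>v \<noteq> a\<close> \<open>v \<noteq> b\<close> by (metis other_endpoint_eq(2) insert_commute)+
  have split: "(\<Sum>f\<in>?E. h f) = (\<Sum>f\<in>E. h f) + h {v, a} + h {v, b}" for h :: "'a set \<Rightarrow> complex"
    using new E(1) by (simp add: insert_commute algebra_simps)
  have old: "w e = 0" if "e \<in> E" for e
  proof -
    have "(\<Sum>f\<in>E. of_real (?Z e f) * w f) = \<mu> * w e" if e: "e \<in> E" for e
    proof -
      \<comment> \<open>The column of a new edge is nonzero only in rows of edges containing its
        other endpoint \<open>v\<close>. No old edge does, so the old rows form a closed
        system.\<close>
      have "v \<noteq> est e" "v \<noteq> other_endpoint est e"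
        using E(2)[OF e] other_endpoint_in[of e est] v by auto
      then have "?Z e {v, a} = 0" "?Z e {v, b} = 0" using oth by (simp_all add: Z_entry_def)
      with eig[of e] e show ?thesis unfolding split by simp
    qed
    with stable \<mu> that show ?thesis unfolding no_unstable_mode_def by blast
  qed
  let ?p = "x v - x a" and ?q = "x v - x b"
  \<comment> \<open>The relative positions are \<open>- ?p\<close> and \<open>- ?q\<close>, whose
    signs cancel. The common minus sign arises because \<open>v\<close> is the other endpoint of
    both edges.\<close>
  have Z: "?Z {v, a} {v, a} = - (?p \<bullet> ?p)" "?Z {v, a} {v, b} = - (?p \<bullet> ?q)"
    "?Z {v, b} {v, a} = - (?p \<bullet> ?q)" "?Z {v, b} {v, b} = - (?q \<bullet> ?q)"
    using est oth \<open>v \<noteq> a\<close> \<open>v \<noteq> b\<close>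
    by (simp_all add: Z_entry_def rel_pos_def inner_real2 algebra_simps)
  have "of_real (?Z {v, a} {v, a}) * w {v, a} + of_real (?Z {v, a} {v, b}) * w {v, b} = \<mu> * w {v, a}"
    "of_real (?Z {v, b} {v, a}) * w {v, a} + of_real (?Z {v, b} {v, b}) * w {v, b} = \<mu> * w {v, b}"
    using eig[of "{v, a}"] eig[of "{v, b}"] old unfolding split by simp_all
  then have "w {v, a} = 0" "w {v, b} = 0"
    using gram_block_stable[OF \<mu> cross, of "w {v, a}" "w {v, b}"] unfolding Z by simp_all
  with old show "\<forall>e\<in>?E. w e = 0" by auto
qed

section \<open>Base graphs: a single edge and the triangles\<close>

lemma edge_length_pos:
  assumes "independent_lengths x {{i, j}}"
  shows "x i \<noteq> x j"
proof
  assume "x i = x j"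
  moreover obtain u where "(x i - x j) \<bullet> (u i - u j) = 1"
    using independent_lengthsD[OF assms, of "\<lambda>_. 1"] by blast
  ultimately show False by simp
qed

lemma edge_only_trivial_flexes:
  assumes "x i \<noteq> x j"
  shows "only_trivial_flexes x {i, j} {{i, j}}"
  unfolding only_trivial_flexes_def
proof (intro allI impI)
  fix u
  assume "\<forall>p q. {p, q} \<in> {{i, j}} \<longrightarrow> (x p - x q) \<bullet> (u p - u q) = 0"
  then have u: "(x i - x j) \<bullet> (u i - u j) = 0" by blast
  define p y where "p = x i - x j" and "y = u i - u j"
  have pos: "p \<bullet> p \<noteq> 0" using assms by (simp add: p_def)
  \<comment> \<open>\<open>cross2 p y\<close> is \<open>perp p \<bullet> y\<close>, so
    \<open>r\<close> is the coefficient of \<open>y\<close> along \<open>perp p\<close> in the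
    orthogonal basis \<open>p\<close>, \<open>perp p\<close>.\<close>
  define r where "r = cross2 p y / (p \<bullet> p)"
  have "(p \<bullet> p) * (y - r *\<^sub>R perp p) $ k = (p \<bullet> y) * p $ k" for k
  proof -
    have "(p \<bullet> p) * (y - r *\<^sub>R perp p) $ k = (p \<bullet> p) * y $ k - cross2 p y * perp p $ k"
      using pos by (simp add: r_def algebra_simps)
    also have "\<dots> = (p \<bullet> y) * p $ k"
      using exhaust_2[of k] by (auto simp: inner_real2 cross2_def algebra_simps)
    finally show ?thesis .
  qed
  then have y: "y = r *\<^sub>R perp p"
    using u pos by (simp add: vec_eq_iff[of y] flip: p_def y_def)
  \<comment> \<open>The translation is fixed by matching the motion at \<open>j\<close>; the formula
    for \<open>y\<close> then gives the match at \<open>i\<close>.\<close>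
  define c where "c = u j - r *\<^sub>R perp (x j)"
  have "u j = c + r *\<^sub>R perp (x j)" by (simp add: c_def)
  moreover have "u i = c + r *\<^sub>R perp (x i)"
  proof -
    have "perp p = perp (x i) - perp (x j)"
      by (simp add: vec_eq_iff forall_2 p_def)
    with y show ?thesis by (simp add: c_def y_def algebra_simps)
  qed
  ultimately show "\<exists>c r. \<forall>p\<in>{i, j}. u p = c + r *\<^sub>R perp (x p)" by blast
qed

text \<open>Start for the triangles in which one agent estimates two edges: they arise from this
  edge by an insertion.\<close>

lemma edge_no_unstable_mode:
  assumes "x i \<noteq> x j" "i \<noteq> j" "est {i, j} = i"
  shows "no_unstable_mode est x {{i, j}}"
  unfolding no_unstable_mode_def
proof (intro allI impI)
  fix \<mu> :: complex and w
  let ?A = "(x i - x j) \<bullet> (x i - x j)"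
  assume \<mu>: "Re \<mu> \<ge> 0"
    and "\<forall>e\<in>{{i, j}}. (\<Sum>f\<in>{{i, j}}. of_real (Z_entry est x e f) * w f) = \<mu> * w e"
  moreover have "Z_entry est x {i, j} {i, j} = - ?A"
    using assms other_endpoint_eq[of i j est] by (simp add: Z_entry_def rel_pos_def)
  ultimately have "of_real (- ?A) * w {i, j} = \<mu> * w {i, j}" by simp
  then have "(\<mu> + of_real ?A) * w {i, j} = 0" by (simp add: algebra_simps)
  moreover have "?A > 0" using assms by simp
  then have "\<mu> + of_real ?A \<noteq> 0" by (rule add_of_real_nonzero[OF \<mu>])
  ultimately show "\<forall>e\<in>{{i, j}}. w e = 0" by simp
qed

lemma cyclic_triangle_no_unstable_mode:
  assumes dist: "i \<noteq> j" "j \<noteq> k" "i \<noteq> k"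
    and est: "est {i, j} = i" "est {j, k} = j" "est {k, i} = k"
    and cross: "cross2 (x k - x i) (x k - x j) \<noteq> 0"
  shows "no_unstable_mode est x {{i, j}, {j, k}, {k, i}}"
  unfolding no_unstable_mode_def
proof (intro allI impI)
  fix \<mu> :: complex and w
  let ?T = "{{i, j}, {j, k}, {k, i}}" and ?Z = "Z_entry est x"
  assume \<mu>: "Re \<mu> \<ge> 0"
    and eig: "\<forall>e\<in>?T. (\<Sum>f\<in>?T. of_real (?Z e f) * w f) = \<mu> * w e"
  have ne: "{i, j} \<noteq> {j, k}" "{i, j} \<noteq> {k, i}" "{j, k} \<noteq> {k, i}"
    using dist by (auto simp: doubleton_eq_iff)
  have oth: "other_endpoint est {i, j} = j" "other_endpoint est {j, k} = k"
    "other_endpoint est {k, i} = i"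
    using est dist by (auto intro!: other_endpoint_eq)
  define p q s where "p = x i - x j" and "q = x j - x k" and "s = x k - x i"
  have rel: "rel_pos est x {i, j} = p" "rel_pos est x {j, k} = q" "rel_pos est x {k, i} = s"
    using est oth by (simp_all add: rel_pos_def p_def q_def s_def)
  \<comment> \<open>The other endpoint of each edge estimates the next edge and is absent from the
    third, so each column has one possibly nonzero off-diagonal entry, with positive sign.\<close>
  have Z: "?Z {i, j} {i, j} = - (p \<bullet> p)" "?Z {i, j} {j, k} = 0" "?Z {i, j} {k, i} = p \<bullet> s"
    "?Z {j, k} {i, j} = q \<bullet> p" "?Z {j, k} {j, k} = - (q \<bullet> q)" "?Z {j, k} {k, i} = 0"
    "?Z {k, i} {i, j} = 0" "?Z {k, i} {j, k} = s \<bullet> q" "?Z {k, i} {k, i} = - (s \<bullet> s)"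
    using est oth dist by (auto simp: Z_entry_def rel)
  have split: "(\<Sum>f\<in>?T. h f) = h {i, j} + h {j, k} + h {k, i}" for h :: "'a set \<Rightarrow> complex"
    using ne by (simp add: add.assoc)
  have e: "of_real (p \<bullet> s) * w {k, i} - of_real (p \<bullet> p) * w {i, j} = \<mu> * w {i, j}"
    "of_real (q \<bullet> p) * w {i, j} - of_real (q \<bullet> q) * w {j, k} = \<mu> * w {j, k}"
    "of_real (s \<bullet> q) * w {j, k} - of_real (s \<bullet> s) * w {k, i} = \<mu> * w {k, i}"
    using eig unfolding split by (simp_all add: Z)
  \<comment> \<open>Since \<open>p + q + s = 0\<close>, these cross products agree up to
    sign.\<close>
  have "cross2 p s \<noteq> 0" "cross2 q p \<noteq> 0" "cross2 s q \<noteq> 0"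
    using cross by (auto simp: cross2_def p_def q_def s_def algebra_simps)
  note c = this[THEN cross2_nonzero_pos(1)] this[THEN cross2_nonzero_pos(3)]
  have "\<bar>(p \<bullet> s) * (q \<bullet> p) * (s \<bullet> q)\<bar> < (p \<bullet> p) * (q \<bullet> q) * (s \<bullet> s)"
  proof (rule power2_less_imp_less)
    \<comment> \<open>Product of the three strict Cauchy-Schwarz inequalities; each squared side
      length occurs twice.\<close>
    have "((p \<bullet> s)\<^sup>2 * (q \<bullet> p)\<^sup>2) * (s \<bullet> q)\<^sup>2
        < (((p \<bullet> p) * (s \<bullet> s)) * ((q \<bullet> q) * (p \<bullet> p))) * ((s \<bullet> s) * (q \<bullet> q))"
      using c by (intro mult_strict_mono) auto
    then show "\<bar>(p \<bullet> s) * (q \<bullet> p) * (s \<bullet> q)\<bar>\<^sup>2 < ((p \<bullet> p) * (q \<bullet> q) * (s \<bullet> s))\<^sup>2"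
      by (simp add: power2_eq_square mult_ac)
  qed (use c in simp)
  from cyclic_block_stable[OF \<mu> c(1-3) this e] show "\<forall>e\<in>?T. w e = 0" by simp
qed

lemma henneberg_edges:
  assumes "henneberg est V E"
  shows "finite E \<and> (\<forall>e\<in>E. e \<subseteq> V \<and> card e = 2)"
  using assms by induction (auto simp: card_insert_if)

text \<open>A triangle is an insertion of \<open>k\<close> onto the edge \<open>{i, j}\<close>, so
  insertion also shows that it is not collinear.\<close>

lemma edge_insertion_nondegenerate:
  assumes "independent_lengths x {{i, j}, {j, k}, {k, i}}" "i \<noteq> j" "j \<noteq> k" "i \<noteq> k"
  shows "x i \<noteq> x j" "cross2 (x k - x i) (x k - x j) \<noteq> 0"
proof -
  show ne: "x i \<noteq> x j"
    by (rule edge_length_pos, rule independent_lengths_mono[OF assms(1)]) auto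
  show "cross2 (x k - x i) (x k - x j) \<noteq> 0"
    by (rule insertion_nondegenerate[OF edge_only_trivial_flexes[of x i j, OF ne]])
      (use assms in \<open>auto simp: insert_commute\<close>)
qed

lemma triangle_only_trivial_flexes:
  assumes "independent_lengths x {{i, j}, {j, k}, {k, i}}" "i \<noteq> j" "j \<noteq> k" "i \<noteq> k"
  shows "only_trivial_flexes x {i, j, k} {{i, j}, {j, k}, {k, i}}"
  using insertion_only_trivial_flexes[OF edge_only_trivial_flexes[of x i j], of k i j]
    edge_insertion_nondegenerate[OF assms]
  by (simp add: insert_commute)

text \<open>If every agent estimates exactly one edge, \<open>est\<close> is injective; failure of
  injectivity therefore selects the second alternative of \<open>triangle_choice\<close>.\<close>

lemma triangle_choice_not_inj:
  assumes "triangle_choice est V T" and est: "\<And>e. e \<in> T \<Longrightarrow> est e \<in> V"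
    and not_inj: "\<not> inj_on est T"
  obtains i j where "i \<in> V" "j \<in> V" "j \<noteq> i"
    "\<forall>e\<in>T. i \<in> e \<longrightarrow> est e = i" "\<forall>e\<in>T. i \<notin> e \<longrightarrow> est e = j"
proof -
  have "inj_on est T" if "\<forall>i\<in>V. \<exists>!e. e \<in> T \<and> est e = i"
    using that est by (intro inj_onI) metis
  with assms(1) not_inj have "\<exists>i\<in>V. \<exists>j\<in>V. j \<noteq> i \<and>
      (\<forall>e\<in>T. i \<in> e \<longrightarrow> est e = i) \<and> (\<forall>e\<in>T. i \<notin> e \<longrightarrow> est e = j)"
    unfolding triangle_choice_def by satx
  then show ?thesis by (elim bexE conjE) (rule that)
qed

text \<open>Symmetry of the triangle: any ordered pair of its agents may be named first.\<close>

lemma doubleton_cycle: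
  assumes "a \<noteq> b" "b \<noteq> c" "a \<noteq> c" "i \<in> {a, b, c}" "j \<in> {a, b, c}" "j \<noteq> i"
  obtains k where "k \<noteq> i" "k \<noteq> j" "{{a, b}, {b, c}, {a, c}} = {{i, j}, {j, k}, {k, i}}"
proof -
  have "i = a \<or> i = b \<or> i = c" "j = a \<or> j = b \<or> j = c" using assms(4,5) by auto
  with assms(6) consider "i = a" "j = b" | "i = a" "j = c" | "i = b" "j = a"
    | "i = b" "j = c" | "i = c" "j = a" | "i = c" "j = b" by metis
  then show thesis
  proof cases
    case 1 then show ?thesis using that[of c] assms(1-3) by (simp add: insert_commute)
  next
    case 2 then show ?thesis using that[of b] assms(1-3) by (simp add: insert_commute)
  next
    case 3 then show ?thesis using that[of c] assms(1-3) by (simp add: insert_commute)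
  next
    case 4 then show ?thesis using that[of a] assms(1-3) by (simp add: insert_commute)
  next
    case 5 then show ?thesis using that[of b] assms(1-3) by (simp add: insert_commute)
  next
    case 6 then show ?thesis using that[of a] assms(1-3) by (simp add: insert_commute)
  qed
qed

lemma triangle_no_unstable_mode:
  assumes indep: "independent_lengths x {{a, b}, {b, c}, {a, c}}"
    and dist: "a \<noteq> b" "b \<noteq> c" "a \<noteq> c"
    and choice: "triangle_choice est {a, b, c} {{a, b}, {b, c}, {a, c}}"
    and est: "\<And>e. e \<in> {{a, b}, {b, c}, {a, c}} \<Longrightarrow> est e \<in> e"
  shows "no_unstable_mode est x {{a, b}, {b, c}, {a, c}}"
proof -
  let ?T = "{{a, b}, {b, c}, {a, c}}"
  have est_V: "est e \<in> {a, b, c}" if "e \<in> ?T" for e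
    using est[OF that] that by blast
  show ?thesis
  proof (cases "inj_on est ?T")
    case True
    have ne: "{a, b} \<noteq> {b, c}" "{a, b} \<noteq> {a, c}" "{b, c} \<noteq> {a, c}"
      using dist by (auto simp: doubleton_eq_iff)
    have est_in: "est {a, b} = a \<or> est {a, b} = b" "est {b, c} = b \<or> est {b, c} = c"
      "est {a, c} = a \<or> est {a, c} = c"
      using est[of "{a, b}"] est[of "{b, c}"] est[of "{a, c}"] by auto
    have neq: "est {a, b} \<noteq> est {b, c}" "est {a, b} \<noteq> est {a, c}" "est {b, c} \<noteq> est {a, c}"
      using True ne unfolding inj_on_def by simp_all
    \<comment> \<open>Only the two cyclic orientations are injective.\<close>
    then consider "est {a, b} = a" "est {b, c} = b" "est {a, c} = c"
      | "est {a, b} = b" "est {a, c} = a" "est {b, c} = c"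
      using est_in by metis
    then show ?thesis
    proof cases
      case 1
      have T: "?T = {{a, b}, {b, c}, {c, a}}" by (simp add: insert_commute)
      show ?thesis
        unfolding T
      proof (rule cyclic_triangle_no_unstable_mode)
        show "cross2 (x c - x a) (x c - x b) \<noteq> 0"
          using edge_insertion_nondegenerate(2)[of x a b c] indep dist unfolding T by blast
      qed (use 1 dist in \<open>simp_all add: insert_commute\<close>)
    next
      case 2
      have T: "?T = {{b, a}, {a, c}, {c, b}}" by (auto simp: insert_commute)
      show ?thesis
        unfolding T
      proof (rule cyclic_triangle_no_unstable_mode)
        show "cross2 (x c - x b) (x c - x a) \<noteq> 0"
          using edge_insertion_nondegenerate(2)[of x b a c] indep dist unfolding T by blast
      qed (use 2 dist in \<open>simp_all add: insert_commute\<close>)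
    qed
  next
    case False
    obtain i j where ij: "i \<in> {a, b, c}" "j \<in> {a, b, c}" "j \<noteq> i"
      and est_ij: "\<forall>e\<in>?T. i \<in> e \<longrightarrow> est e = i" "\<forall>e\<in>?T. i \<notin> e \<longrightarrow> est e = j"
      by (rule triangle_choice_not_inj[OF choice est_V False])
    obtain k where k: "k \<noteq> i" "k \<noteq> j" and T: "?T = {{i, j}, {j, k}, {k, i}}"
      by (rule doubleton_cycle[OF dist ij])
    \<comment> \<open>Here \<open>k\<close> estimates no edge, so the triangle is an insertion of
      \<open>k\<close> onto \<open>{i, j}\<close>.\<close>
    have T': "?T = {{i, j}} \<union> {{k, i}, {k, j}}"
      unfolding T by (simp add: insert_commute)
    have e: "est {i, j} = i" "est {k, i} = i" "est {k, j} = j"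
      using est_ij ij(3) k unfolding T' by simp_all
    have nd: "x i \<noteq> x j" "cross2 (x k - x i) (x k - x j) \<noteq> 0"
      using edge_insertion_nondegenerate[of x i j k] indep ij(3) k unfolding T by auto
    show ?thesis
      unfolding T'
      by (rule insertion_no_unstable_mode[OF edge_no_unstable_mode[of x i j, OF nd(1)] nd(2), where V = "{i, j}"])
        (use e k ij(3) in auto)
  qed
qed

section \<open>Induction along the Henneberg sequence\<close>

text \<open>Both properties are carried together: triviality of the flexes of the old graph makes
  the next Gram block nonsingular.\<close>

lemma henneberg_no_unstable_mode:
  assumes "henneberg est V E" "\<And>e. e \<in> E \<Longrightarrow> est e \<in> e" "independent_lengths x E"
  shows "only_trivial_flexes x V E \<and> no_unstable_mode est x E"
  using assms
proof induction
  case (triangle a b c)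
  then show ?case
    using triangle_no_unstable_mode[of x a b c est] triangle_only_trivial_flexes[of x a b c]
    by (simp add: insert_commute)
next
  case (insertion V E v a b)
  have "independent_lengths x E"
    using insertion.prems(2) by (rule independent_lengths_mono) auto
  with insertion have IH: "only_trivial_flexes x V E" "no_unstable_mode est x E" by auto
  have E: "finite E" "\<And>e. e \<in> E \<Longrightarrow> e \<subseteq> V" "\<And>e. e \<in> E \<Longrightarrow> card e = 2"
    using henneberg_edges[OF insertion.hyps(1)] by auto
  have nd: "cross2 (x v - x a) (x v - x b) \<noteq> 0"
    by (rule insertion_nondegenerate[OF IH(1) insertion.prems(2) E(2)]) (use insertion.hyps in auto)
  show ?case
    using insertion_only_trivial_flexes[OF IH(1) nd]
      insertion_no_unstable_mode[OF IH(2) nd E(1), of V] E insertion.hyps insertion.prems(1)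
    by simp
qed

section \<open>From the block matrices to quantities indexed by edges\<close>

lemma rigidity_matrix_nth:
  "rigidity_matrix edge est z $ k $ (i, p) = z $ k $ p * incidence_matrix edge est $ k $ i"
proof -
  have "rigidity_matrix edge est z $ k $ (i, p) =
      (\<Sum>(l, q)\<in>UNIV. (if l = k then z $ k $ q else 0) *
        (incidence_matrix edge est $ l $ i * (if q = p then 1 else 0)))"
    by (simp add: rigidity_matrix_def matrix_matrix_mult_def transpose_def D_matrix_def
        kronecker_def mat_def case_prod_beta)
  also have "\<dots> = (\<Sum>c\<in>UNIV. if c = (k, p) then z $ k $ p * incidence_matrix edge est $ k $ i else 0)"
    by (intro sum.cong refl) (auto split: if_splits)
  finally show ?thesis by simp
qed

lemma S1_matrix_nth:
  "S1_matrix edge est z $ k $ (i, p) =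
     z $ k $ p * (let h = incidence_matrix edge est $ k $ i in if h = - 1 then 0 else h)"
proof -
  have "S1_matrix edge est z $ k $ (i, p) =
      (\<Sum>(l, q)\<in>UNIV. (if l = k then z $ k $ q else 0) *
        (let h = incidence_matrix edge est $ l $ i * (if q = p then 1 else 0)
         in if h = - 1 then 0 else h))"
    by (simp add: S1_matrix_def matrix_matrix_mult_def transpose_def D_matrix_def J_matrix_def
        kronecker_def mat_def case_prod_beta)
  also have "\<dots> = (\<Sum>c\<in>UNIV. if c = (k, p) then z $ k $ p *
      (let h = incidence_matrix edge est $ k $ i in if h = - 1 then 0 else h) else 0)"
    by (intro sum.cong refl) (auto simp: Let_def split: if_splits)
  finally show ?thesis by simp
qed

lemma Z_matrix_nth:
  fixes x :: "'n::finite \<Rightarrow> real^2" and edge :: "'e::finite \<Rightarrow> 'n set"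
  assumes "\<And>k. card (edge k) = 2" "\<And>k. est (edge k) \<in> edge k"
  shows "Z_matrix edge est (relative_positions edge est x) $ k $ l = Z_entry est x (edge k) (edge l)"
proof -
  let ?z = "relative_positions edge est x" and ?o = "\<lambda>k. other_endpoint est (edge k)"
  let ?R = "rigidity_matrix edge est ?z" and ?S = "S1_matrix edge est ?z"
    and ?H = "incidence_matrix edge est"
  have ne: "?o k \<noteq> est (edge k)" for k
    using other_endpoint_in(2)[of "edge k" est] assms by simp
  \<comment> \<open>Factored as R times the transpose of S1 - R.\<close>
  have "Z_matrix edge est ?z $ k $ l = (\<Sum>c\<in>UNIV. ?R $ k $ c * (?S $ l $ c - ?R $ l $ c))"
    by (simp add: Z_matrix_def matrix_matrix_mult_def transpose_def right_diff_distrib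
        sum_subtractf)
  also have "\<dots> = (\<Sum>i\<in>UNIV. \<Sum>p\<in>UNIV. ?R $ k $ (i, p) * (?S $ l $ (i, p) - ?R $ l $ (i, p)))"
    by (simp add: UNIV_Times_UNIV[symmetric] sum.cartesian_product del: UNIV_Times_UNIV)
  \<comment> \<open>Row \<open>l\<close> of S1 - R cancels at the estimating agent and leaves
    \<open>?z $ l\<close> at the other endpoint.\<close>
  also have "\<dots> = (\<Sum>i\<in>UNIV. \<Sum>p\<in>UNIV. if i = ?o l then ?z $ k $ p * ?z $ l $ p * ?H $ k $ i else 0)"
    by (intro sum.cong refl)
      (use ne[of l] in \<open>auto simp: rigidity_matrix_nth S1_matrix_nth incidence_matrix_def\<close>)
  also have "\<dots> = (\<Sum>i\<in>UNIV. if i = ?o l then (?z $ k \<bullet> ?z $ l) * ?H $ k $ i else 0)"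
    by (intro sum.cong refl) (simp add: inner_vec_def sum_distrib_right)
  also have "\<dots> = (?z $ k \<bullet> ?z $ l) * ?H $ k $ ?o l" by (simp add: sum.delta)
  also have "\<dots> = Z_entry est x (edge k) (edge l)"
    by (simp add: Z_entry_def rel_pos_def relative_positions_def incidence_matrix_def)
  finally show ?thesis .
qed

text \<open>Identifies R as the derivative of half the squared edge lengths.\<close>

lemma rigidity_matrix_mult_nth:
  fixes x :: "'n::finite \<Rightarrow> real^2" and edge :: "'e::finite \<Rightarrow> 'n set"
  assumes "card (edge k) = 2" "est (edge k) \<in> edge k"
  shows "(rigidity_matrix edge est (relative_positions edge est x) *v y) $ k =
    rel_pos est x (edge k) \<bullet>
      ((\<chi> p. y $ (est (edge k), p)) - (\<chi> p. y $ (other_endpoint est (edge k), p)))"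
proof -
  let ?z = "relative_positions edge est x" and ?o = "other_endpoint est (edge k)"
  let ?e = "est (edge k)"
  have ne: "?o \<noteq> ?e"
    using other_endpoint_in(2)[of "edge k" est] assms by simp
  have "(rigidity_matrix edge est ?z *v y) $ k =
      (\<Sum>i\<in>UNIV. \<Sum>p\<in>UNIV. rigidity_matrix edge est ?z $ k $ (i, p) * y $ (i, p))"
    by (simp add: matrix_vector_mult_def UNIV_Times_UNIV[symmetric] sum.cartesian_product
        del: UNIV_Times_UNIV)
  also have "\<dots> = (\<Sum>p\<in>UNIV. \<Sum>i\<in>UNIV. (if i = ?e then ?z $ k $ p * y $ (i, p) else 0)
      - (if i = ?o then ?z $ k $ p * y $ (i, p) else 0))"
    by (subst sum.swap, intro sum.cong refl)
      (use ne in \<open>auto simp: rigidity_matrix_nth incidence_matrix_def\<close>)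
  also have "\<dots> = (\<Sum>p\<in>UNIV. ?z $ k $ p * (y $ (?e, p) - y $ (?o, p)))"
    by (simp add: sum_subtractf sum.delta right_diff_distrib)
  finally show ?thesis
    by (simp add: inner_vec_def rel_pos_def relative_positions_def)
qed

text \<open>Minimality makes the rank equal to the number of rows, so R is surjective and all rates
  are attained.\<close>

lemma minimally_rigid_independent_lengths:
  fixes edge :: "'e::finite \<Rightarrow> 'n::finite set"
  assumes "inj edge" and card: "\<And>k. card (edge k) = 2" and est: "\<And>k. est (edge k) \<in> edge k"
    and "infinitesimally_minimally_rigid edge est x"
  shows "independent_lengths x (range edge)"
  unfolding independent_lengths_def
proof
  fix g :: "'n set \<Rightarrow> real"
  let ?R = "rigidity_matrix edge est (relative_positions edge est x)"
  have "rank ?R = CARD('e)"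
    using assms(4) card_image[OF assms(1)]
    by (simp add: infinitesimally_minimally_rigid_def infinitesimally_rigid_def)
  then have "surj ((*v) ?R)" by (simp add: full_rank_surjective)
  then obtain y where y: "?R *v y = (\<chi> k. g (edge k))" by (metis surjD)
  define u where "u i = (\<chi> p. y $ (i, p))" for i
  have "(x p - x q) \<bullet> (u p - u q) = g {p, q}" if "{p, q} \<in> range edge" for p q
  proof -
    from that obtain k where k: "edge k = {p, q}" by auto
    let ?e = "est (edge k)" and ?o = "other_endpoint est (edge k)"
    have "(x ?e - x ?o) \<bullet> (u ?e - u ?o) = (?R *v y) $ k"
      using rigidity_matrix_mult_nth[of edge k est x y] card est by (simp add: rel_pos_def u_def)
    also have "\<dots> = g {p, q}" by (simp add: y k)
    finally have eq: "(x ?e - x ?o) \<bullet> (u ?e - u ?o) = g {p, q}" .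
    have "{?e, ?o} = {p, q}" using other_endpoint_in(3)[of "edge k" est] card est k by metis
    then consider "?e = p" "?o = q" | "?e = q" "?o = p" by (auto simp: doubleton_eq_iff)
    then show ?thesis
      using eq by cases (auto simp: algebra_simps)
  qed
  then show "\<exists>u. \<forall>p q. {p, q} \<in> range edge \<longrightarrow> (x p - x q) \<bullet> (u p - u q) = g {p, q}" by blast
qed

theorem mainTheorem4:
  fixes edge :: "'e::finite \<Rightarrow> 'n::finite set"
    and est :: "'n set \<Rightarrow> 'n"
    and d :: "'e \<Rightarrow> real"
    and x :: "'n \<Rightarrow> real^2"
    and z :: "real^2^'e"
  assumes simple_graph: "inj edge" "\<And>k. card (edge k) = 2"
    and estimating_agent: "\<And>k. est (edge k) \<in> edge k"
    and generated: "henneberg est UNIV (range edge)"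
    and relative_positions: "z = relative_positions edge est x"
    and desired: "\<And>k. norm (z $ k) = d k"
    and rigid: "infinitesimally_minimally_rigid edge est x"
  shows "hurwitz (Z_matrix edge est z)"
  unfolding hurwitz_def
proof (intro allI impI, rule ccontr)
  fix \<mu>
  assume "complex_eigenvalue (Z_matrix edge est z) \<mu>" and "\<not> Re \<mu> < 0"
  then obtain v :: "complex^'e" where v: "v \<noteq> 0"
    "(\<chi> i j. complex_of_real (Z_matrix edge est z $ i $ j)) *v v = \<mu> *s v" and \<mu>: "Re \<mu> \<ge> 0"
    by (auto simp: complex_eigenvalue_def)
  \<comment> \<open>Moves the eigenvector from labels to edges; injectivity of \<open>edge\<close>
    makes this lossless.\<close>
  define w where "w e = v $ inv edge e" for e
  have w: "w (edge k) = v $ k" for k by (simp add: w_def simple_graph(1))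
  have "no_unstable_mode est x (range edge)"
    using henneberg_no_unstable_mode[OF generated]
      minimally_rigid_independent_lengths[OF simple_graph estimating_agent rigid] estimating_agent
    by blast
  moreover have "\<forall>e\<in>range edge.
      (\<Sum>f\<in>range edge. of_real (Z_entry est x e f) * w f) = \<mu> * w e"
  proof clarify
    fix k
    have "(\<Sum>l\<in>UNIV. complex_of_real (Z_matrix edge est z $ k $ l) * v $ l) = \<mu> * v $ k"
      using v(2) by (simp add: vec_eq_iff matrix_vector_mult_def)
    then show "(\<Sum>f\<in>range edge. of_real (Z_entry est x (edge k) f) * w f) = \<mu> * w (edge k)"
      by (simp add: sum.reindex simple_graph(1) w relative_positions
          Z_matrix_nth[of edge est, OF simple_graph(2) estimating_agent])
  qed
  ultimately have "w (edge k) = 0" for k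
    using \<mu> unfolding no_unstable_mode_def by blast
  with w v(1) show False by (simp add: vec_eq_iff)
qed

end
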